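(* Consider an abundant conformally superintegrable system in dimension $n\geqslant3$ with structure tensor data $S_{ijk}$, $\bar t$ (so that $$\nabla^a\bar t_a=\tfrac{3}{2(n-1)}R+\tfrac{3n+2}{6(n-1)(n+2)}S^{abc}S_{abc}-\tfrac{n-2}{6}\bar t^a\bar t_a \qquad(1)$$ holds with $\bar t_a=\nabla_a\bar t$), and let $\sigma=e^{-\frac13\bar t}$. If $$S^{abc}S_{abc}-(n-1)(n+2)\,\bar t^a\bar t_a=9R, \qquad(2)$$ then equation $(1)$ becomes $$\Delta\sigma^{n+2}=-2\,\frac{n+1}{n-1}\,R\,\sigma^{n+2}.$$
   Context: $(M,g)$ is an $n$-dimensional pseudo-Riemannian manifold with Levi-Civita connection $\nabla$, Laplacian $\Delta=\nabla^a\nabla_a$ and scalar curvature $R$ (positive on round spheres); commas denote covariant derivatives. A (second order) conformally superintegrable system is a Hamiltonian $H=g^{ij}p_ip_j+V$ with $2n-1$ functionally independent conformal integrals (including $H$) $F=C^{ij}p_ip_j+W$, $\{F,H\}=2\omega(p)H$, i.e. $C_{(ij,k)}=g_{(ij}\omega_{k)}$ and $dW=C\,dV+\omega V$; all $C$ except the metric are trace-free. With $\mathcal C$ the space of such $C$, $\mathcal V^{\max}$ is the space of $V$ satisfying $d(C\,dV)+V\,d\omega+dV\wedge\omega=0$ for all $C\in\mathcal C$, and $\mathcal C^{\max}$ the space of conformal Killing tensors satisfying it for all $V\in\mathcal V^{\max}$. The system is non-degenerate if its potentials satisfy $V_{,ij}=T_{ij}{}^mV_{,m}+\frac1ng_{ij}\Delta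 V+\tau_{ij}V$ with $T$, $\tau$ symmetric and trace-free in $i,j$ and with an $(n+2)$-dimensional solution space $\mathcal V^{\max}$; abundant if moreover the trace-free tensors in $\mathcal C^{\max}$ span dimension $\frac{n(n+1)}2-1$. Then $T_{ijk}=S_{ijk}+\bar t_ig_{jk}+\bar t_jg_{ik}-\frac2ng_{ij}\bar t_k$ with $S_{ijk}$ totally symmetric trace-free, and $\bar t_i=\bar t_{,i}$ for a function $\bar t$ (unique up to a constant). (Condition (2) is known to hold for abundant properly superintegrable systems on manifolds of constant sectional curvature.) *)

theory Defs
  imports "HOL-Analysis.Analysis" "HOL-Library.Function_Algebras"
begin

section \<open>Smooth manifolds and tensor fields in local charts\<close>

text \<open>
  A chart is a domain in the manifold together with a coordinate map into \<open>real ^ 'n\<close>,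
  and the dimension is \<open>CARD('n)\<close>. The underlying set of the manifold is the whole type \<open>'m\<close>.
  Tensor fields are families of components, one array for each chart and each point of its domain,
  subject to the usual transformation law. All partial derivatives are taken
  in chart coordinates but evaluated at points of the manifold.
\<close>

type_synonym ('m, 'n) chart = "'m set \<times> ('m \<Rightarrow> real ^ 'n)"

type_synonym ('m, 'n, 't) field = "('m, 'n) chart \<Rightarrow> 'm \<Rightarrow> 't"

abbreviation chart_dom :: "('m, 'n) chart \<Rightarrow> 'm set" where
  "chart_dom c \<equiv> fst c"

abbreviation coord :: "('m, 'n) chart \<Rightarrow> 'm \<Rightarrow> real ^ 'n" where
  "coord c \<equiv> snd c"

definition chart_inv :: "('m, 'n) chart \<Rightarrow> real ^ 'n \<Rightarrow> 'm" where
  "chart_inv c = inv_into (chart_dom c) (coord c)"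

text \<open>\<open>Ck_on k U f\<close> is continuous differentiability of order \<open>k\<close>; it is only used for open \<open>U\<close>.\<close>

primrec Ck_on :: "nat \<Rightarrow> (real ^ 'n) set \<Rightarrow> (real ^ 'n \<Rightarrow> real) \<Rightarrow> bool" where
  "Ck_on 0 U f \<longleftrightarrow> continuous_on U f"
| "Ck_on (Suc k) U f \<longleftrightarrow> (\<forall>x\<in>U. f differentiable (at x)) \<and>
     (\<forall>i. Ck_on k U (\<lambda>x. frechet_derivative f (at x) (axis i 1)))"

definition smooth_on :: "(real ^ 'n) set \<Rightarrow> (real ^ 'n \<Rightarrow> real) \<Rightarrow> bool" where
  "smooth_on U f \<longleftrightarrow> (\<forall>k. Ck_on k U f)"

definition smooth_atlas ::
  "('m::{t2_space, second_countable_topology}, 'n::finite) chart set \<Rightarrow> bool" where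
  "smooth_atlas A \<longleftrightarrow>
     (\<Union>c\<in>A. chart_dom c) = UNIV \<and>
     (\<forall>c\<in>A. open (chart_dom c) \<and> open (coord c ` chart_dom c) \<and>
        homeomorphism (chart_dom c) (coord c ` chart_dom c) (coord c) (chart_inv c)) \<and>
     (\<forall>c\<in>A. \<forall>d\<in>A. \<forall>i.
        smooth_on (coord c ` (chart_dom c \<inter> chart_dom d)) (\<lambda>x. coord d (chart_inv c x) $ i))"

text \<open>\<open>pd c k f p\<close> is \<open>\<partial>f/\<partial>x\<^sup>k\<close> at \<open>p\<close>, where \<open>x\<close> are the coordinates of the chart \<open>c\<close>.\<close>

definition pd :: "('m, 'n::finite) chart \<Rightarrow> 'n \<Rightarrow> ('m \<Rightarrow> real) \<Rightarrow> 'm \<Rightarrow> real" where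
  "pd c k f p = frechet_derivative (\<lambda>x. f (chart_inv c x)) (at (coord c p)) (axis k 1)"

definition smooth_in :: "('m, 'n::finite) chart \<Rightarrow> ('m \<Rightarrow> real) \<Rightarrow> bool" where
  "smooth_in c f \<longleftrightarrow> smooth_on (coord c ` chart_dom c) (\<lambda>x. f (chart_inv c x))"

definition scalar_field :: "('m, 'n::finite) chart set \<Rightarrow> ('m \<Rightarrow> real) \<Rightarrow> bool" where
  "scalar_field A f \<longleftrightarrow> (\<forall>c\<in>A. smooth_in c f)"

text \<open>Jacobian \<open>jac c d p a i = \<partial>y\<^sup>a/\<partial>x\<^sup>i\<close> for coordinates \<open>x\<close> of \<open>c\<close> and \<open>y\<close> of \<open>d\<close>.\<close>

definition jac :: "('m, 'n::finite) chart \<Rightarrow> ('m, 'n) chart \<Rightarrow> 'm \<Rightarrow> 'n \<Rightarrow> 'n \<Rightarrow> real" where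
  "jac c d p a i = pd c i (\<lambda>q. coord d q $ a) p"

text \<open>
  Covariant tensor fields of rank 1, 2 and 3. The components are set to zero where they carry no
  meaning (outside the atlas or outside the chart domain), so that a tensor field is determined by
  its actual components and spaces of tensor fields have the expected dimension.
\<close>

definition off_zero :: "('m, 'n) chart set \<Rightarrow> ('m, 'n, 't::zero) field \<Rightarrow> bool" where
  "off_zero A X \<longleftrightarrow> (\<forall>c p. c \<notin> A \<or> p \<notin> chart_dom c \<longrightarrow> X c p = 0)"

definition tensor1 :: "('m, 'n::finite) chart set \<Rightarrow> ('m, 'n, real ^ 'n) field \<Rightarrow> bool" where
  "tensor1 A X \<longleftrightarrow> off_zero A X \<and>
     (\<forall>c\<in>A. \<forall>i. smooth_in c (\<lambda>p. X c p $ i)) \<and>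
     (\<forall>c\<in>A. \<forall>d\<in>A. \<forall>p\<in>chart_dom c \<inter> chart_dom d. \<forall>i.
        X c p $ i = (\<Sum>a\<in>UNIV. jac c d p a i * X d p $ a))"

definition tensor2 :: "('m, 'n::finite) chart set \<Rightarrow> ('m, 'n, real ^ 'n ^ 'n) field \<Rightarrow> bool" where
  "tensor2 A X \<longleftrightarrow> off_zero A X \<and>
     (\<forall>c\<in>A. \<forall>i j. smooth_in c (\<lambda>p. X c p $ i $ j)) \<and>
     (\<forall>c\<in>A. \<forall>d\<in>A. \<forall>p\<in>chart_dom c \<inter> chart_dom d. \<forall>i j.
        X c p $ i $ j = (\<Sum>a\<in>UNIV. \<Sum>b\<in>UNIV. jac c d p a i * jac c d p b j * X d p $ a $ b))"

definition tensor3 ::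
  "('m, 'n::finite) chart set \<Rightarrow> ('m, 'n, real ^ 'n ^ 'n ^ 'n) field \<Rightarrow> bool" where
  "tensor3 A X \<longleftrightarrow> off_zero A X \<and>
     (\<forall>c\<in>A. \<forall>i j k. smooth_in c (\<lambda>p. X c p $ i $ j $ k)) \<and>
     (\<forall>c\<in>A. \<forall>d\<in>A. \<forall>p\<in>chart_dom c \<inter> chart_dom d. \<forall>i j k.
        X c p $ i $ j $ k = (\<Sum>a\<in>UNIV. \<Sum>b\<in>UNIV. \<Sum>e\<in>UNIV.
          jac c d p a i * jac c d p b j * jac c d p e k * X d p $ a $ b $ e))"

definition sym2 :: "('m, 'n::finite) chart set \<Rightarrow> ('m, 'n, real ^ 'n ^ 'n) field \<Rightarrow> bool" where
  "sym2 A X \<longleftrightarrow> (\<forall>c\<in>A. \<forall>p\<in>chart_dom c. \<forall>i j. X c p $ i $ j = X c p $ j $ i)"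


section \<open>Pseudo-Riemannian geometry\<close>

definition pseudo_riemannian ::
  "('m::{t2_space, second_countable_topology}, 'n::finite) chart set \<Rightarrow>
   ('m, 'n, real ^ 'n ^ 'n) field \<Rightarrow> bool" where
  "pseudo_riemannian A g \<longleftrightarrow> smooth_atlas A \<and> tensor2 A g \<and> sym2 A g \<and>
     (\<forall>c\<in>A. \<forall>p\<in>chart_dom c. invertible (g c p))"

text \<open>\<open>ginv g c p $ i $ j\<close> is \<open>g\<^sup>i\<^sup>j\<close>.\<close>

definition ginv :: "('m, 'n::finite, real ^ 'n ^ 'n) field \<Rightarrow> ('m, 'n, real ^ 'n ^ 'n) field" where
  "ginv g c p = matrix_inv (g c p)"

text \<open>\<open>christoffel g c p k i j\<close> is the Levi-Civita symbol \<open>\<Gamma>\<^sup>k\<^sub>i\<^sub>j\<close>.\<close>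

definition christoffel ::
  "('m, 'n::finite, real ^ 'n ^ 'n) field \<Rightarrow> ('m, 'n) chart \<Rightarrow> 'm \<Rightarrow> 'n \<Rightarrow> 'n \<Rightarrow> 'n \<Rightarrow> real" where
  "christoffel g c p k i j = (1/2) * (\<Sum>l\<in>UNIV. ginv g c p $ k $ l *
     (pd c i (\<lambda>q. g c q $ j $ l) p + pd c j (\<lambda>q. g c q $ i $ l) p - pd c l (\<lambda>q. g c q $ i $ j) p))"

text \<open>\<open>nabla1 g c X p i j\<close> is \<open>X\<^sub>i\<^sub>,\<^sub>j\<close> and \<open>nabla2 g c X p i j k\<close> is \<open>X\<^sub>i\<^sub>j\<^sub>,\<^sub>k\<close>.\<close>

definition nabla1 :: "('m, 'n::finite, real ^ 'n ^ 'n) field \<Rightarrow> ('m, 'n) chart \<Rightarrow>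
    ('m \<Rightarrow> real ^ 'n) \<Rightarrow> 'm \<Rightarrow> 'n \<Rightarrow> 'n \<Rightarrow> real" where
  "nabla1 g c X p i j =
     pd c j (\<lambda>q. X q $ i) p - (\<Sum>k\<in>UNIV. christoffel g c p k i j * X p $ k)"

definition nabla2 :: "('m, 'n::finite, real ^ 'n ^ 'n) field \<Rightarrow> ('m, 'n) chart \<Rightarrow>
    ('m \<Rightarrow> real ^ 'n ^ 'n) \<Rightarrow> 'm \<Rightarrow> 'n \<Rightarrow> 'n \<Rightarrow> 'n \<Rightarrow> real" where
  "nabla2 g c X p i j k = pd c k (\<lambda>q. X q $ i $ j) p
     - (\<Sum>l\<in>UNIV. christoffel g c p l k i * X p $ l $ j)
     - (\<Sum>l\<in>UNIV. christoffel g c p l k j * X p $ i $ l)"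

definition grad :: "('m, 'n::finite) chart \<Rightarrow> ('m \<Rightarrow> real) \<Rightarrow> 'm \<Rightarrow> real ^ 'n" where
  "grad c f p = (\<chi> i. pd c i f p)"

text \<open>\<open>divergence g c X p\<close> is \<open>\<nabla>\<^sup>a X\<^sub>a\<close>.\<close>

definition divergence :: "('m, 'n::finite, real ^ 'n ^ 'n) field \<Rightarrow> ('m, 'n) chart \<Rightarrow>
    ('m \<Rightarrow> real ^ 'n) \<Rightarrow> 'm \<Rightarrow> real" where
  "divergence g c X p = (\<Sum>i\<in>UNIV. \<Sum>j\<in>UNIV. ginv g c p $ i $ j * nabla1 g c X p i j)"

definition hessian :: "('m, 'n::finite, real ^ 'n ^ 'n) field \<Rightarrow> ('m, 'n) chart \<Rightarrow>
    ('m \<Rightarrow> real) \<Rightarrow> 'm \<Rightarrow> 'n \<Rightarrow> 'n \<Rightarrow> real" where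
  "hessian g c f = nabla1 g c (grad c f)"

definition laplacian :: "('m, 'n::finite, real ^ 'n ^ 'n) field \<Rightarrow> ('m, 'n) chart \<Rightarrow>
    ('m \<Rightarrow> real) \<Rightarrow> 'm \<Rightarrow> real" where
  "laplacian g c f = divergence g c (grad c f)"

text \<open>
  \<open>riemann g c p l k i j\<close> is \<open>R\<^sup>l\<^sub>k\<^sub>i\<^sub>j\<close>, the \<open>\<partial>\<^sub>l\<close>-component of \<open>R(\<partial>\<^sub>i, \<partial>\<^sub>j) \<partial>\<^sub>k\<close> with
  \<open>R(X, Y) = [\<nabla>\<^sub>X, \<nabla>\<^sub>Y] - \<nabla>\<^sub>[\<^sub>X\<^sub>,\<^sub>Y\<^sub>]\<close>. The contraction below makes \<open>R\<close> positive on round spheres.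
\<close>

definition riemann :: "('m, 'n::finite, real ^ 'n ^ 'n) field \<Rightarrow> ('m, 'n) chart \<Rightarrow>
    'm \<Rightarrow> 'n \<Rightarrow> 'n \<Rightarrow> 'n \<Rightarrow> 'n \<Rightarrow> real" where
  "riemann g c p l k i j =
     pd c i (\<lambda>q. christoffel g c q l j k) p - pd c j (\<lambda>q. christoffel g c q l i k) p
     + (\<Sum>m\<in>UNIV. christoffel g c p l i m * christoffel g c p m j k
                 - christoffel g c p l j m * christoffel g c p m i k)"

definition scalar_curvature ::
  "('m, 'n::finite, real ^ 'n ^ 'n) field \<Rightarrow> ('m, 'n) chart \<Rightarrow> 'm \<Rightarrow> real" where
  "scalar_curvature g c p =
     (\<Sum>k\<in>UNIV. \<Sum>j\<in>UNIV. ginv g c p $ k $ j * (\<Sum>i\<in>UNIV. riemann g c p i k i j))"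

text \<open>Full contractions \<open>X\<^sup>a X\<^sub>a\<close> and \<open>X\<^sup>a\<^sup>b\<^sup>c X\<^sub>a\<^sub>b\<^sub>c\<close>, of either sign in general signature.\<close>

definition sq1 :: "('m, 'n::finite, real ^ 'n ^ 'n) field \<Rightarrow> ('m, 'n) chart \<Rightarrow>
    ('m \<Rightarrow> real ^ 'n) \<Rightarrow> 'm \<Rightarrow> real" where
  "sq1 g c X p = (\<Sum>a\<in>UNIV. \<Sum>b\<in>UNIV. ginv g c p $ a $ b * X p $ a * X p $ b)"

definition sq3 :: "('m, 'n::finite, real ^ 'n ^ 'n) field \<Rightarrow> ('m, 'n) chart \<Rightarrow>
    ('m \<Rightarrow> real ^ 'n ^ 'n ^ 'n) \<Rightarrow> 'm \<Rightarrow> real" where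
  "sq3 g c X p = (\<Sum>a\<in>UNIV. \<Sum>b\<in>UNIV. \<Sum>e\<in>UNIV. \<Sum>a'\<in>UNIV. \<Sum>b'\<in>UNIV. \<Sum>e'\<in>UNIV.
     ginv g c p $ a $ a' * ginv g c p $ b $ b' * ginv g c p $ e $ e' *
     X p $ a $ b $ e * X p $ a' $ b' $ e')"

definition trace_free2 :: "('m, 'n::finite) chart set \<Rightarrow> ('m, 'n, real ^ 'n ^ 'n) field \<Rightarrow>
    ('m, 'n, real ^ 'n ^ 'n) field \<Rightarrow> bool" where
  "trace_free2 A g X \<longleftrightarrow> (\<forall>c\<in>A. \<forall>p\<in>chart_dom c.
     (\<Sum>i\<in>UNIV. \<Sum>j\<in>UNIV. ginv g c p $ i $ j * X c p $ i $ j) = 0)"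

text \<open>Symmetry and trace-freeness in the first two indices.\<close>

definition sym_trace_free12 :: "('m, 'n::finite) chart set \<Rightarrow> ('m, 'n, real ^ 'n ^ 'n) field \<Rightarrow>
    ('m, 'n, real ^ 'n ^ 'n ^ 'n) field \<Rightarrow> bool" where
  "sym_trace_free12 A g X \<longleftrightarrow> (\<forall>c\<in>A. \<forall>p\<in>chart_dom c. \<forall>k.
     (\<forall>i j. X c p $ i $ j $ k = X c p $ j $ i $ k) \<and>
     (\<Sum>i\<in>UNIV. \<Sum>j\<in>UNIV. ginv g c p $ i $ j * X c p $ i $ j $ k) = 0)"

definition total_sym3 :: "('m, 'n::finite) chart set \<Rightarrow>
    ('m, 'n, real ^ 'n ^ 'n ^ 'n) field \<Rightarrow> bool" where
  "total_sym3 A X \<longleftrightarrow> (\<forall>c\<in>A. \<forall>p\<in>chart_dom c. \<forall>i j k.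
     X c p $ i $ j $ k = X c p $ j $ i $ k \<and> X c p $ i $ j $ k = X c p $ i $ k $ j)"


section \<open>Hamiltonians on the cotangent bundle and conformal integrals\<close>

text \<open>
  Points of the cotangent bundle are given by \<open>q\<close> in a chart domain and momenta \<open>p\<close> with respect to
  the canonical fibre coordinates of that chart. Tensors \<open>C\<close> are stored with lower indices, so
  \<open>phase_fun g C W\<close> is \<open>C\<^sup>i\<^sup>j p\<^sub>i p\<^sub>j + W\<close> and \<open>phase_fun g g V\<close> is the Hamiltonian \<open>g\<^sup>i\<^sup>j p\<^sub>i p\<^sub>j + V\<close>.
\<close>

definition phase_fun :: "('m, 'n::finite, real ^ 'n ^ 'n) field \<Rightarrow>
    ('m, 'n, real ^ 'n ^ 'n) field \<Rightarrow> ('m \<Rightarrow> real) \<Rightarrow>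
    ('m, 'n) chart \<Rightarrow> 'm \<Rightarrow> real ^ 'n \<Rightarrow> real" where
  "phase_fun g C W c q p =
     (\<Sum>i\<in>UNIV. \<Sum>j\<in>UNIV. (ginv g c q ** C c q ** ginv g c q) $ i $ j * p $ i * p $ j) + W q"

definition dq :: "('m, 'n::finite) chart \<Rightarrow> ('m \<Rightarrow> real ^ 'n \<Rightarrow> real) \<Rightarrow>
    'm \<Rightarrow> real ^ 'n \<Rightarrow> real ^ 'n" where
  "dq c F q p = (\<chi> k. pd c k (\<lambda>q'. F q' p) q)"

definition dp :: "('m \<Rightarrow> real ^ 'n::finite \<Rightarrow> real) \<Rightarrow> 'm \<Rightarrow> real ^ 'n \<Rightarrow> real ^ 'n" where
  "dp F q p = (\<chi> k. frechet_derivative (F q) (at p) (axis k 1))"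

definition poisson :: "('m, 'n::finite) chart \<Rightarrow> ('m \<Rightarrow> real ^ 'n \<Rightarrow> real) \<Rightarrow>
    ('m \<Rightarrow> real ^ 'n \<Rightarrow> real) \<Rightarrow> 'm \<Rightarrow> real ^ 'n \<Rightarrow> real" where
  "poisson c F G q p = (\<Sum>k\<in>UNIV. dq c F q p $ k * dp G q p $ k - dp F q p $ k * dq c G q p $ k)"

text \<open>\<open>{F, H} = 2 \<omega>(p) H\<close> with \<open>\<omega>(p) = g\<^sup>i\<^sup>j \<omega>\<^sub>i p\<^sub>j\<close>.\<close>

definition conformal_integral :: "('m, 'n::finite) chart set \<Rightarrow>
    ('m, 'n, real ^ 'n ^ 'n) field \<Rightarrow> ('m \<Rightarrow> real) \<Rightarrow>
    ('m, 'n, real ^ 'n ^ 'n) field \<Rightarrow> ('m \<Rightarrow> real) \<Rightarrow> ('m, 'n, real ^ 'n) field \<Rightarrow> bool" where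
  "conformal_integral A g V C W \<omega> \<longleftrightarrow>
     tensor2 A C \<and> sym2 A C \<and> scalar_field A W \<and> tensor1 A \<omega> \<and>
     (\<forall>c\<in>A. \<forall>q\<in>chart_dom c. \<forall>p.
        poisson c (phase_fun g C W c) (phase_fun g g V c) q p =
        2 * (\<Sum>i\<in>UNIV. \<Sum>j\<in>UNIV. ginv g c q $ i $ j * \<omega> c q $ i * p $ j) * phase_fun g g V c q p)"

text \<open>
  Functional independence of \<open>F\<^sub>0, \<dots>, F\<^sub>N\<^sub>-\<^sub>1\<close>: the differentials are linearly independent on a
  dense subset of the cotangent bundle.
\<close>

definition functionally_independent ::
  "('m::topological_space, 'n::finite) chart set \<Rightarrow> nat \<Rightarrow>
   (nat \<Rightarrow> ('m, 'n) chart \<Rightarrow> 'm \<Rightarrow> real ^ 'n \<Rightarrow> real) \<Rightarrow> bool" where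
  "functionally_independent A N F \<longleftrightarrow> (\<forall>c\<in>A. chart_dom c \<times> UNIV \<subseteq> closure
     {(q, p). q \<in> chart_dom c \<and>
        (\<forall>a. (\<Sum>\<alpha><N. a \<alpha> *\<^sub>R dq c (F \<alpha> c) q p) = 0 \<and> (\<Sum>\<alpha><N. a \<alpha> *\<^sub>R dp (F \<alpha> c) q p) = 0
           \<longrightarrow> (\<forall>\<alpha><N. a \<alpha> = (0::real)))})"

text \<open>
  A conformally superintegrable system: the integrals are \<open>C \<alpha>\<^sup>i\<^sup>j p\<^sub>i p\<^sub>j + W \<alpha>\<close> for
  \<open>\<alpha> = 0, \<dots>, 2n - 2\<close>, the one with \<open>\<alpha> = 0\<close> being the Hamiltonian.
\<close>

definition conf_superintegrable ::
  "('m::{t2_space, second_countable_topology}, 'n::finite) chart set \<Rightarrow>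
   ('m, 'n, real ^ 'n ^ 'n) field \<Rightarrow> ('m \<Rightarrow> real) \<Rightarrow>
   (nat \<Rightarrow> ('m, 'n, real ^ 'n ^ 'n) field) \<Rightarrow> (nat \<Rightarrow> 'm \<Rightarrow> real) \<Rightarrow> bool" where
  "conf_superintegrable A g V C W \<longleftrightarrow>
     pseudo_riemannian A g \<and> scalar_field A V \<and> C 0 = g \<and> W 0 = V \<and>
     (\<forall>\<alpha> < 2 * CARD('n) - 1. \<exists>\<omega>. conformal_integral A g V (C \<alpha>) (W \<alpha>) \<omega>) \<and>
     (\<forall>\<alpha> \<in> {1 ..< 2 * CARD('n) - 1}. trace_free2 A g (C \<alpha>)) \<and>
     functionally_independent A (2 * CARD('n) - 1) (\<lambda>\<alpha>. phase_fun g (C \<alpha>) (W \<alpha>))"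


section \<open>The spaces of compatible potentials and conformal Killing tensors\<close>

text \<open>\<open>C\<^sub>(\<^sub>i\<^sub>j\<^sub>,\<^sub>k\<^sub>) = g\<^sub>(\<^sub>i\<^sub>j \<omega>\<^sub>k\<^sub>)\<close>; the 1-form \<open>\<omega>\<close> is determined by \<open>C\<close>.\<close>

definition conformal_killing :: "('m, 'n::finite) chart set \<Rightarrow>
    ('m, 'n, real ^ 'n ^ 'n) field \<Rightarrow> ('m, 'n, real ^ 'n ^ 'n) field \<Rightarrow>
    ('m, 'n, real ^ 'n) field \<Rightarrow> bool" where
  "conformal_killing A g C \<omega> \<longleftrightarrow> tensor2 A C \<and> sym2 A C \<and> tensor1 A \<omega> \<and>
     (\<forall>c\<in>A. \<forall>p\<in>chart_dom c. \<forall>i j k.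
        nabla2 g c (C c) p i j k + nabla2 g c (C c) p j k i + nabla2 g c (C c) p k i j =
        g c p $ i $ j * \<omega> c p $ k + g c p $ j $ k * \<omega> c p $ i + g c p $ k $ i * \<omega> c p $ j)"

definition ext_d :: "('m, 'n::finite) chart \<Rightarrow> ('m \<Rightarrow> real ^ 'n) \<Rightarrow> 'm \<Rightarrow> 'n \<Rightarrow> 'n \<Rightarrow> real" where
  "ext_d c \<theta> p i j = pd c i (\<lambda>q. \<theta> q $ j) p - pd c j (\<lambda>q. \<theta> q $ i) p"

text \<open>\<open>d(C dV) + V d\<omega> + dV \<and> \<omega> = 0\<close>, where \<open>(C dV)\<^sub>i = C\<^sub>i\<^sup>j V\<^sub>,\<^sub>j\<close>.\<close>

definition bertrand_darboux :: "('m, 'n::finite) chart set \<Rightarrow>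
    ('m, 'n, real ^ 'n ^ 'n) field \<Rightarrow> ('m, 'n, real ^ 'n ^ 'n) field \<Rightarrow>
    ('m, 'n, real ^ 'n) field \<Rightarrow> ('m \<Rightarrow> real) \<Rightarrow> bool" where
  "bertrand_darboux A g C \<omega> V \<longleftrightarrow> (\<forall>c\<in>A. \<forall>p\<in>chart_dom c. \<forall>i j.
     ext_d c (\<lambda>q. (C c q ** ginv g c q) *v grad c V q) p i j
     + V p * ext_d c (\<omega> c) p i j
     + (grad c V p $ i * \<omega> c p $ j - grad c V p $ j * \<omega> c p $ i) = 0)"

text \<open>The linear span of the tensors \<open>C 0, \<dots>, C (N - 1)\<close>.\<close>

definition span_C :: "nat \<Rightarrow> (nat \<Rightarrow> ('m, 'n::finite, real ^ 'n ^ 'n) field) \<Rightarrow>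
    ('m, 'n, real ^ 'n ^ 'n) field set" where
  "span_C N C = {(\<lambda>c p. \<Sum>\<alpha><N. a \<alpha> *\<^sub>R C \<alpha> c p) | a. True}"

definition V_max :: "('m, 'n::finite) chart set \<Rightarrow> ('m, 'n, real ^ 'n ^ 'n) field \<Rightarrow>
    ('m, 'n, real ^ 'n ^ 'n) field set \<Rightarrow> ('m \<Rightarrow> real) set" where
  "V_max A g \<C> = {V. scalar_field A V \<and>
     (\<forall>C\<in>\<C>. \<forall>\<omega>. conformal_killing A g C \<omega> \<longrightarrow> bertrand_darboux A g C \<omega> V)}"

definition C_max :: "('m, 'n::finite) chart set \<Rightarrow> ('m, 'n, real ^ 'n ^ 'n) field \<Rightarrow>
    ('m, 'n, real ^ 'n ^ 'n) field set \<Rightarrow> ('m, 'n, real ^ 'n ^ 'n) field set" where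
  "C_max A g \<C> = {C. \<exists>\<omega>. conformal_killing A g C \<omega> \<and>
     (\<forall>V\<in>V_max A g \<C>. bertrand_darboux A g C \<omega> V)}"

text \<open>
  Dimensions of spaces of functions and of tensor fields, with pointwise operations. Note that
  \<open>vector_space.dim\<close> is zero on infinite-dimensional spaces.
\<close>

definition scale_fun :: "real \<Rightarrow> ('m \<Rightarrow> real) \<Rightarrow> 'm \<Rightarrow> real" where
  "scale_fun r f = (\<lambda>p. r * f p)"

definition scale_field :: "real \<Rightarrow> ('m, 'n, real ^ 'n ^ 'n) field \<Rightarrow>
    ('m, 'n::finite, real ^ 'n ^ 'n) field" where
  "scale_field r X = (\<lambda>c p. r *\<^sub>R X c p)"

lemma vector_space_scale_fun: "vector_space scale_fun"
  by unfold_locales (auto simp: scale_fun_def fun_eq_iff algebra_simps)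

lemma vector_space_scale_field: "vector_space scale_field"
  by unfold_locales (auto simp: scale_field_def fun_eq_iff algebra_simps)

text \<open>\<open>V\<^sub>,\<^sub>i\<^sub>j = T\<^sub>i\<^sub>j\<^sup>m V\<^sub>,\<^sub>m + (1/n) g\<^sub>i\<^sub>j \<Delta>V + \<tau>\<^sub>i\<^sub>j V\<close>\<close>

definition wilczynski :: "('m, 'n::finite) chart set \<Rightarrow> ('m, 'n, real ^ 'n ^ 'n) field \<Rightarrow>
    ('m, 'n, real ^ 'n ^ 'n ^ 'n) field \<Rightarrow> ('m, 'n, real ^ 'n ^ 'n) field \<Rightarrow>
    ('m \<Rightarrow> real) \<Rightarrow> bool" where
  "wilczynski A g T \<tau> V \<longleftrightarrow> (\<forall>c\<in>A. \<forall>p\<in>chart_dom c. \<forall>i j.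
     hessian g c V p i j =
       (\<Sum>m\<in>UNIV. \<Sum>l\<in>UNIV. T c p $ i $ j $ m * ginv g c p $ m $ l * grad c V p $ l)
       + 1 / real CARD('n) * g c p $ i $ j * laplacian g c V p
       + \<tau> c p $ i $ j * V p)"

definition nondegenerate ::
  "('m::{t2_space, second_countable_topology}, 'n::finite) chart set \<Rightarrow>
   ('m, 'n, real ^ 'n ^ 'n) field \<Rightarrow> ('m \<Rightarrow> real) \<Rightarrow>
   (nat \<Rightarrow> ('m, 'n, real ^ 'n ^ 'n) field) \<Rightarrow> (nat \<Rightarrow> 'm \<Rightarrow> real) \<Rightarrow>
   ('m, 'n, real ^ 'n ^ 'n ^ 'n) field \<Rightarrow> ('m, 'n, real ^ 'n ^ 'n) field \<Rightarrow> bool" where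
  "nondegenerate A g V C W T \<tau> \<longleftrightarrow>
     conf_superintegrable A g V C W \<and>
     tensor3 A T \<and> sym_trace_free12 A g T \<and>
     tensor2 A \<tau> \<and> sym2 A \<tau> \<and> trace_free2 A g \<tau> \<and>
     V_max A g (span_C (2 * CARD('n) - 1) C) = {U. scalar_field A U \<and> wilczynski A g T \<tau> U} \<and>
     vector_space.dim scale_fun (V_max A g (span_C (2 * CARD('n) - 1) C)) = CARD('n) + 2"

definition abundant ::
  "('m::{t2_space, second_countable_topology}, 'n::finite) chart set \<Rightarrow>
   ('m, 'n, real ^ 'n ^ 'n) field \<Rightarrow> ('m \<Rightarrow> real) \<Rightarrow>
   (nat \<Rightarrow> ('m, 'n, real ^ 'n ^ 'n) field) \<Rightarrow> (nat \<Rightarrow> 'm \<Rightarrow> real) \<Rightarrow>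
   ('m, 'n, real ^ 'n ^ 'n ^ 'n) field \<Rightarrow> ('m, 'n, real ^ 'n ^ 'n) field \<Rightarrow> bool" where
  "abundant A g V C W T \<tau> \<longleftrightarrow>
     nondegenerate A g V C W T \<tau> \<and>
     vector_space.dim scale_field
       {K \<in> C_max A g (span_C (2 * CARD('n) - 1) C). trace_free2 A g K}
     = CARD('n) * (CARD('n) + 1) div 2 - 1"

text \<open>
  \<open>T\<^sub>i\<^sub>j\<^sub>k = S\<^sub>i\<^sub>j\<^sub>k + t\<^sub>i g\<^sub>j\<^sub>k + t\<^sub>j g\<^sub>i\<^sub>k - (2/n) g\<^sub>i\<^sub>j t\<^sub>k\<close> with \<open>S\<close> totally symmetric and trace-free and
  \<open>t\<^sub>i\<close> the differential of the function \<open>t\<close>.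
\<close>

definition structure_data ::
  "('m, 'n::finite) chart set \<Rightarrow> ('m, 'n, real ^ 'n ^ 'n) field \<Rightarrow>
   ('m, 'n, real ^ 'n ^ 'n ^ 'n) field \<Rightarrow> ('m, 'n, real ^ 'n ^ 'n ^ 'n) field \<Rightarrow>
   ('m \<Rightarrow> real) \<Rightarrow> bool" where
  "structure_data A g T S t \<longleftrightarrow>
     tensor3 A S \<and> total_sym3 A S \<and> sym_trace_free12 A g S \<and> scalar_field A t \<and>
     (\<forall>c\<in>A. \<forall>p\<in>chart_dom c. \<forall>i j k.
        T c p $ i $ j $ k = S c p $ i $ j $ k
          + grad c t p $ i * g c p $ j $ k + grad c t p $ j * g c p $ i $ k
          - 2 / real CARD('n) * g c p $ i $ j * grad c t p $ k)"

text \<open>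
  The structure equation for the divergence of \<open>t\<^sub>a = \<nabla>\<^sub>a t\<close> at the point \<open>p\<close>:
  \<open>\<nabla>\<^sup>a t\<^sub>a = 3/(2(n-1)) R + (3n+2)/(6(n-1)(n+2)) S\<^sup>a\<^sup>b\<^sup>c S\<^sub>a\<^sub>b\<^sub>c - (n-2)/6 t\<^sup>a t\<^sub>a\<close>.
\<close>

definition divergence_eq :: "('m, 'n::finite, real ^ 'n ^ 'n) field \<Rightarrow>
    ('m, 'n, real ^ 'n ^ 'n ^ 'n) field \<Rightarrow> ('m \<Rightarrow> real) \<Rightarrow> ('m, 'n) chart \<Rightarrow> 'm \<Rightarrow> bool" where
  "divergence_eq g S t c p \<longleftrightarrow> (let n = real CARD('n) in
     divergence g c (grad c t) p =
       3 / (2 * (n - 1)) * scalar_curvature g c p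
       + (3 * n + 2) / (6 * (n - 1) * (n + 2)) * sq3 g c (S c) p
       - (n - 2) / 6 * sq1 g c (grad c t) p)"

end

theory Submission
  imports Defs
begin

text \<open>
  For a twice differentiable function \<open>\<phi>\<close> of one real variable the chain rule gives
  \<open>\<Delta>(\<phi> \<circ> t) = \<phi>'(t) \<Delta>t + \<phi>''(t) t\<^sup>a t\<^sub>a\<close> with \<open>t\<^sub>a = \<nabla>\<^sub>a t\<close>,
  because the Christoffel terms of the Hessian are linear in the first derivatives. Now
  \<open>\<sigma>\<^sup>n\<^sup>+\<^sup>2 = exp (a t)\<close> with \<open>a = -(n + 2)/3\<close>, so \<open>\<Delta>\<sigma>\<^sup>n\<^sup>+\<^sup>2 = a \<sigma>\<^sup>n\<^sup>+\<^sup>2 (\<Delta>t + a t\<^sup>a t\<^sub>a)\<close>. Eliminating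
  \<open>S\<^sup>a\<^sup>b\<^sup>c S\<^sub>a\<^sub>b\<^sub>c\<close> from the structure equation by means of the condition on \<open>R\<close> leaves
  \<open>\<Delta>t = 6(n+1)/((n-1)(n+2)) R + (n+2)/3 t\<^sup>a t\<^sub>a\<close>,
  and the exponent \<open>n + 2\<close> is the one for which the quadratic gradient term cancels. What remains,
  \<open>\<Delta>\<sigma>\<^sup>n\<^sup>+\<^sup>2 = a \<sigma>\<^sup>n\<^sup>+\<^sup>2 \<cdot> 6(n+1)/((n-1)(n+2)) R\<close>, is the asserted equation. As
  \<open>a \<noteq> 0\<close> and \<open>\<sigma> > 0\<close>, every step can be reversed, so the two equations are equivalent at each
  point separately. This computation is local: it takes place in one chart.
\<close>

lemma chart_inv_coord:
  assumes "smooth_atlas A" "c \<in> A" "p \<in> chart_dom c"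
  shows "chart_inv c (coord c p) = p"
  using assms by (auto simp: smooth_atlas_def homeomorphism_def)

lemma eventually_in_chart:
  assumes "smooth_atlas A" "c \<in> A" "p \<in> chart_dom c"
  shows "\<forall>\<^sub>F x in nhds (coord c p).
    chart_inv c x \<in> chart_dom c \<and> coord c (chart_inv c x) = x"
proof -
  have "open (coord c ` chart_dom c)"
    and inv: "\<And>q. q \<in> chart_dom c \<Longrightarrow> chart_inv c (coord c q) = q"
    using assms by (auto simp: smooth_atlas_def homeomorphism_def)
  then have "\<forall>\<^sub>F x in nhds (coord c p). x \<in> coord c ` chart_dom c"
    using assms(3) by (intro eventually_nhds_in_open) auto
  then show ?thesis
    by eventually_elim (auto simp: inv)
qed

abbreviation differentiable_in :: "('m, 'n::finite) chart \<Rightarrow> ('m \<Rightarrow> real) \<Rightarrow> 'm \<Rightarrow> bool" where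
  "differentiable_in c f p \<equiv> (\<lambda>x. f (chart_inv c x)) differentiable at (coord c p)"

lemma has_derivative_cong_nhds:
  assumes D: "(f has_derivative D) (at x)" and ev: "\<forall>\<^sub>F y in nhds x. f y = h y"
  shows "(h has_derivative D) (at x)"
  using D filter_leD[OF at_within_le_nhds ev] eventually_nhds_x_imp_x[OF ev] UNIV_I
  by (rule has_derivative_transform_eventually)

text \<open>
  Partial derivatives depend only on the germ of a function. Formulae for first derivatives hold
  only on the chart domain, and this is what allows them to be differentiated once more.
\<close>

lemma pd_cong_on_chart:
  assumes "smooth_atlas A" "c \<in> A" "p \<in> chart_dom c"
    and eq: "\<And>q. q \<in> chart_dom c \<Longrightarrow> f q = h q"
  shows "pd c i f p = pd c i h p"
proof -
  have ev: "\<forall>\<^sub>F x in nhds (coord c p). f (chart_inv c x) = h (chart_inv c x)"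
    using eventually_in_chart[OF assms(1-3)] by eventually_elim (simp add: eq)
  then have ev': "\<forall>\<^sub>F x in nhds (coord c p). h (chart_inv c x) = f (chart_inv c x)"
    by eventually_elim simp
  have "((\<lambda>x. f (chart_inv c x)) has_derivative D) (at (coord c p)) \<longleftrightarrow>
        ((\<lambda>x. h (chart_inv c x)) has_derivative D) (at (coord c p))" for D
    using has_derivative_cong_nhds[OF _ ev] has_derivative_cong_nhds[OF _ ev']
    by blast
  then show ?thesis
    by (simp add: pd_def frechet_derivative_def)
qed

lemma smooth_in_differentiable:
  assumes "smooth_in c f" "p \<in> chart_dom c"
  shows "differentiable_in c f p"
proof -
  have "Ck_on (Suc 0) (coord c ` chart_dom c) (\<lambda>x. f (chart_inv c x))"
    using assms(1) by (simp only: smooth_in_def smooth_on_def)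
  then show ?thesis using assms(2) by simp
qed

lemma smooth_in_differentiable_pd:
  assumes "smooth_atlas A" "c \<in> A" "p \<in> chart_dom c" "smooth_in c f"
  shows "differentiable_in c (pd c i f) p"
proof -
  let ?F = "\<lambda>x. frechet_derivative (\<lambda>x. f (chart_inv c x)) (at x) (axis i 1)"
  have "Ck_on (Suc (Suc 0)) (coord c ` chart_dom c) (\<lambda>x. f (chart_inv c x))"
    using assms(4) by (simp only: smooth_in_def smooth_on_def)
  then have "?F differentiable at (coord c p)"
    using assms(3) by simp
  then obtain D where D: "(?F has_derivative D) (at (coord c p))"
    by (auto simp: differentiable_def)
  have ev: "\<forall>\<^sub>F x in nhds (coord c p). ?F x = pd c i f (chart_inv c x)"
    using eventually_in_chart[OF assms(1-3)] by eventually_elim (simp add: pd_def)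
  show ?thesis
    using has_derivative_cong_nhds[OF D ev] by (auto simp: differentiable_def)
qed

lemma pd_compose:
  assumes f: "differentiable_in c f p"
    and inv: "chart_inv c (coord c p) = p"
    and \<phi>: "(\<phi> has_real_derivative d) (at (f p))"
  shows "((\<lambda>x. \<phi> (f (chart_inv c x))) has_derivative
           (\<lambda>v. d * frechet_derivative (\<lambda>x. f (chart_inv c x)) (at (coord c p)) v)) (at (coord c p))"
    and "pd c i (\<lambda>q. \<phi> (f q)) p = d * pd c i f p"
proof -
  let ?F = "\<lambda>x. f (chart_inv c x)"
  have "(?F has_derivative frechet_derivative ?F (at (coord c p))) (at (coord c p))"
    using f by (simp add: frechet_derivative_works)
  moreover have "(\<phi> has_derivative (*) d) (at (?F (coord c p)))"
    using \<phi> by (simp add: has_field_derivative_def inv)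
  ultimately show D: "((\<lambda>x. \<phi> (?F x)) has_derivative
      (\<lambda>v. d * frechet_derivative ?F (at (coord c p)) v)) (at (coord c p))"
    by (rule has_derivative_compose)
  show "pd c i (\<lambda>q. \<phi> (f q)) p = d * pd c i f p"
    unfolding pd_def frechet_derivative_at[OF D, symmetric] ..
qed

lemma pd_mult:
  assumes "differentiable_in c f p" "differentiable_in c h p"
    and inv: "chart_inv c (coord c p) = p"
  shows "pd c i (\<lambda>q. f q * h q) p = f p * pd c i h p + pd c i f p * h p"
proof -
  let ?F = "\<lambda>x. f (chart_inv c x)" and ?H = "\<lambda>x. h (chart_inv c x)" and ?x = "coord c p"
  have D: "((\<lambda>x. ?F x * ?H x) has_derivative
      (\<lambda>v. ?F ?x * frechet_derivative ?H (at ?x) v + frechet_derivative ?F (at ?x) v * ?H ?x)) (at ?x)"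
    using assms(1,2) by (intro has_derivative_mult) (simp_all add: frechet_derivative_works)
  show ?thesis
    unfolding pd_def frechet_derivative_at[OF D, symmetric] by (simp add: inv)
qed

text \<open>
  The second-order chain rule \<open>\<nabla>\<^sub>j\<nabla>\<^sub>i (\<phi> \<circ> f) = \<phi>'(f) \<nabla>\<^sub>j\<nabla>\<^sub>i f + \<phi>''(f) f\<^sub>,\<^sub>i f\<^sub>,\<^sub>j\<close>: only the
  second partial derivatives produce a quadratic term.
\<close>

lemma hessian_compose:
  assumes atlas: "smooth_atlas A" and c: "c \<in> A" and p: "p \<in> chart_dom c"
    and f: "smooth_in c f"
    and \<phi>: "\<And>x. (\<phi> has_real_derivative \<phi>' x) (at x)"
    and \<phi>': "\<And>x. (\<phi>' has_real_derivative \<phi>'' x) (at x)"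
  shows "hessian g c (\<lambda>q. \<phi> (f q)) p i j =
    \<phi>' (f p) * hessian g c f p i j + \<phi>'' (f p) * grad c f p $ i * grad c f p $ j"
proof -
  note inv = chart_inv_coord[OF atlas c]
  have first: "pd c k (\<lambda>q. \<phi> (f q)) q = \<phi>' (f q) * pd c k f q" if "q \<in> chart_dom c" for k q
    using pd_compose(2)[OF smooth_in_differentiable[OF f that] inv[OF that] \<phi>] .
  have \<phi>'_diff: "differentiable_in c (\<lambda>q. \<phi>' (f q)) p"
    using pd_compose(1)[OF smooth_in_differentiable[OF f p] inv[OF p] \<phi>']
    by (auto simp: differentiable_def)
  have "pd c j (\<lambda>q. pd c i (\<lambda>q. \<phi> (f q)) q) p = pd c j (\<lambda>q. \<phi>' (f q) * pd c i f q) p"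
    by (rule pd_cong_on_chart[OF atlas c p]) (rule first)
  also have "\<dots> = \<phi>' (f p) * pd c j (pd c i f) p + pd c j (\<lambda>q. \<phi>' (f q)) p * pd c i f p"
    by (rule pd_mult[OF \<phi>'_diff smooth_in_differentiable_pd[OF atlas c p f] inv[OF p]])
  also have "pd c j (\<lambda>q. \<phi>' (f q)) p = \<phi>'' (f p) * pd c j f p"
    by (rule pd_compose(2)[OF smooth_in_differentiable[OF f p] inv[OF p] \<phi>'])
  finally show ?thesis
    by (simp add: hessian_def nabla1_def grad_def first[OF p] sum_distrib_left algebra_simps)
qed

lemma laplacian_compose:
  assumes "smooth_atlas A" "c \<in> A" "p \<in> chart_dom c" "smooth_in c f"
    and "\<And>x. (\<phi> has_real_derivative \<phi>' x) (at x)"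
    and "\<And>x. (\<phi>' has_real_derivative \<phi>'' x) (at x)"
  shows "laplacian g c (\<lambda>q. \<phi> (f q)) p =
    \<phi>' (f p) * laplacian g c f p + \<phi>'' (f p) * sq1 g c (grad c f) p"
  using hessian_compose[OF assms]
  by (simp add: laplacian_def divergence_def sq1_def hessian_def
      sum_distrib_left sum.distrib algebra_simps)

text \<open>
  The scalar part of the argument, with \<open>L\<close>, \<open>Q\<close> and \<open>s\<close> standing for \<open>\<Delta>t\<close>, \<open>t\<^sup>a t\<^sub>a\<close> and
  \<open>S\<^sup>a\<^sup>b\<^sup>c S\<^sub>a\<^sub>b\<^sub>c\<close>. Under the hypothesis the \<open>Q\<close>-coefficient in the structure equation becomes
  \<open>(3n+2)/6 - (n-2)/6 = (n+2)/3\<close>, which is \<open>-a\<close> for the exponent \<open>a\<close> of \<open>\<sigma>\<^sup>n\<^sup>+\<^sup>2 = exp (a t)\<close>.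
\<close>

lemma structure_equation_iff:
  fixes n L R Q s :: real
  assumes n: "n > 1" and cond: "s - (n - 1) * (n + 2) * Q = 9 * R"
  defines "a \<equiv> - (n + 2) / 3"
  shows "L = 3 / (2 * (n - 1)) * R + (3 * n + 2) / (6 * (n - 1) * (n + 2)) * s - (n - 2) / 6 * Q
     \<longleftrightarrow> a * L + a\<^sup>2 * Q = - 2 * ((n + 1) / (n - 1)) * R"
proof -
  have s: "s = 9 * R + (n - 1) * (n + 2) * Q" using cond by simp
  have nz: "n - 1 \<noteq> 0" "n + 2 \<noteq> 0" "a \<noteq> 0" using n by (auto simp: a_def)
  have "3 / (2 * (n - 1)) * R + (3 * n + 2) / (6 * (n - 1) * (n + 2)) * s - (n - 2) / 6 * Q
      = 6 * (n + 1) / ((n - 1) * (n + 2)) * R - a * Q"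
    using nz unfolding s a_def by (simp add: divide_simps) algebra
  moreover have "L = 6 * (n + 1) / ((n - 1) * (n + 2)) * R - a * Q \<longleftrightarrow>
      a * L = a * (6 * (n + 1) / ((n - 1) * (n + 2)) * R - a * Q)"
    using nz by simp
  moreover have "a * (6 * (n + 1) / ((n - 1) * (n + 2)) * R - a * Q)
      = - 2 * ((n + 1) / (n - 1)) * R - a\<^sup>2 * Q"
    using nz(1,2) unfolding a_def by (simp add: divide_simps) algebra
  ultimately show ?thesis by argo
qed

theorem theorem6p13:
  fixes A :: "('m::{t2_space, second_countable_topology}, 'n::finite) chart set"
    and g :: "('m, 'n, real ^ 'n ^ 'n) field"
    and V t \<sigma> :: "'m \<Rightarrow> real"
    and C :: "nat \<Rightarrow> ('m, 'n, real ^ 'n ^ 'n) field"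
    and W :: "nat \<Rightarrow> 'm \<Rightarrow> real"
    and T S :: "('m, 'n, real ^ 'n ^ 'n ^ 'n) field"
    and \<tau> :: "('m, 'n, real ^ 'n ^ 'n) field"
    and n :: real
  assumes n_def: "n = real CARD('n)"
    and dim: "CARD('n) \<ge> 3"
    and system: "abundant A g V C W T \<tau>"
    and struct: "structure_data A g T S t"
    and sigma: "\<sigma> = (\<lambda>p. exp (- (1/3) * t p))"
    and cond: "\<forall>c\<in>A. \<forall>p\<in>chart_dom c.
      sq3 g c (S c) p - (n - 1) * (n + 2) * sq1 g c (grad c t) p = 9 * scalar_curvature g c p"
  shows "(\<forall>c\<in>A. \<forall>p\<in>chart_dom c. divergence_eq g S t c p \<longleftrightarrow>
        laplacian g c (\<lambda>q. \<sigma> q ^ (CARD('n) + 2)) p =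
          - 2 * ((n + 1) / (n - 1)) * scalar_curvature g c p * \<sigma> p ^ (CARD('n) + 2))
    \<and> ((\<forall>c\<in>A. \<forall>p\<in>chart_dom c. divergence_eq g S t c p) \<longrightarrow>
       (\<forall>c\<in>A. \<forall>p\<in>chart_dom c.
        laplacian g c (\<lambda>q. \<sigma> q ^ (CARD('n) + 2)) p =
          - 2 * ((n + 1) / (n - 1)) * scalar_curvature g c p * \<sigma> p ^ (CARD('n) + 2)))"
proof -
  let ?N = "CARD('n) + 2"
  define a where "a = - (n + 2) / 3"
  have atlas: "smooth_atlas A"
    using system by (simp add: abundant_def nondegenerate_def conf_superintegrable_def
        pseudo_riemannian_def)
  have \<sigma>_pow: "\<sigma> q ^ ?N = exp (a * t q)" for q
    by (simp add: sigma a_def n_def exp_of_nat_mult[symmetric] algebra_simps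
        del: power_add power_Suc)
  have pointwise: "divergence_eq g S t c p \<longleftrightarrow> laplacian g c (\<lambda>q. \<sigma> q ^ ?N) p =
      - 2 * ((n + 1) / (n - 1)) * scalar_curvature g c p * \<sigma> p ^ ?N"
    if c: "c \<in> A" and p: "p \<in> chart_dom c" for c p
  proof -
    let ?R = "scalar_curvature g c p" and ?Q = "sq1 g c (grad c t) p"
      and ?L = "laplacian g c t p"
    have t: "smooth_in c t"
      using struct c by (simp add: structure_data_def scalar_field_def)
    have "laplacian g c (\<lambda>q. exp (a * t q)) p =
        a * exp (a * t p) * ?L + a\<^sup>2 * exp (a * t p) * ?Q"
      by (rule laplacian_compose[OF atlas c p t, where \<phi> = "\<lambda>x. exp (a * x)"
            and \<phi>' = "\<lambda>x. a * exp (a * x)" and \<phi>'' = "\<lambda>x. a\<^sup>2 * exp (a * x)"])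
        (auto intro!: derivative_eq_intros simp: power2_eq_square)
    then have lap: "laplacian g c (\<lambda>q. \<sigma> q ^ ?N) p = (a * ?L + a\<^sup>2 * ?Q) * \<sigma> p ^ ?N"
      by (simp only: \<sigma>_pow) (simp add: algebra_simps)
    have "n > 1" using dim n_def by simp
    then have "divergence_eq g S t c p \<longleftrightarrow> a * ?L + a\<^sup>2 * ?Q = - 2 * ((n + 1) / (n - 1)) * ?R"
      using structure_equation_iff[of n "sq3 g c (S c) p" ?Q ?R ?L] cond c p
      by (simp only: divergence_eq_def Let_def n_def[symmetric] laplacian_def a_def)
    moreover have "\<sigma> p ^ ?N \<noteq> 0" by (simp only: \<sigma>_pow) simp
    ultimately show ?thesis by (simp only: lap mult_cancel_right simp_thms)
  qed
  then show ?thesis by blast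
qed

end
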